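(* Let $(A,\phi)$ be an $n$-pre-Lie algebra and let $\tau:A\to\mathbb K$ be a $\phi$-trace. Then $(A,\phi_\tau)$ is an $(n+1)$-pre-Lie algebra, where $$\phi_\tau(x_1,\dots,x_n,x_{n+1})=\sum_{k=1}^n(-1)^{k+1}\tau(x_k)\,\phi(x_1,\dots,\widehat{x_k},\dots,x_n,x_{n+1}).$$
   Context: $\mathbb K$ is a field of characteristic $0$; all vector spaces are finite dimensional over $\mathbb K$; $n\ge 2$ is an integer; a hat means omission. For $m\ge2$, an $m$-pre-Lie algebra is a vector space $A$ with an $m$-linear map $\{\cdot,\cdots,\cdot\}:(\wedge^{m-1}A)\otimes A\to A$ (skew-symmetric in the first $m-1$ arguments) such that for all $x_i,y_i\in A$: $$\{x_1,\dots,x_{m-1},\{y_1,\dots,y_m\}\}=\sum_{i=1}^{m-1}\{y_1,\dots,y_{i-1},[x_1,\dots,x_{m-1},y_i]^C,y_{i+1},\dots,y_m\}+\{y_1,\dots,y_{m-1},\{x_1,\dots,x_{m-1},y_m\}\},$$ $$\{[x_1,\dots,x_m]^C,y_1,\dots,y_{m-1}\}=\sum_{i=1}^m(-1)^{m-i}\{x_1,\dots,\widehat{x_i},\dots,x_m,\{x_i,y_1,\dots,y_{m-1}\}\},$$ where $[x_1,\dots,x_m]^C=\sum_{i=1}^m(-1)^{m-i}\{x_1,\dots,\widehat{x_i},\dots,x_m,x_i\}$. For an $n$-linear map $\phi:\otimes^nA\to A$, a linear map $\tau:A\to\mathbb K$ is a $\phi$-trace if $\tau(\phi(x_1,\dots,x_n))=0$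 for all $x_i\in A$. *)

theory Defs
  imports Complex_Main
begin

text \<open>An \<open>m\<close>-ary operation on \<open>A\<close> is a function on lists, of which only the values on lists of
  length \<open>m\<close> matter. List positions are counted from \<open>0\<close>, so the \<open>i\<close>-th argument of the usual
  formulas sits at position \<open>i - 1\<close>; exponents of signs are shifted accordingly.\<close>

text \<open>The list with the entry at position \<open>i\<close> omitted (the hat notation).\<close>

definition omit_nth :: "nat \<Rightarrow> 'a list \<Rightarrow> 'a list" where
  "omit_nth i xs = take i xs @ drop (Suc i) xs"

definition multilinear ::
  "('k::field \<Rightarrow> 'a::ab_group_add \<Rightarrow> 'a) \<Rightarrow> nat \<Rightarrow> ('a list \<Rightarrow> 'a) \<Rightarrow> bool" where
  "multilinear scale m \<phi> \<longleftrightarrow>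
     (\<forall>xs i. length xs = m \<longrightarrow> i < m \<longrightarrow>
        Vector_Spaces.linear scale scale (\<lambda>v. \<phi> (xs[i := v])))"

text \<open>Skew-symmetry of an \<open>m\<close>-ary operation in its first \<open>p\<close> arguments.\<close>

definition skew_symmetric_first :: "nat \<Rightarrow> nat \<Rightarrow> ('a list \<Rightarrow> 'a::ab_group_add) \<Rightarrow> bool" where
  "skew_symmetric_first p m \<phi> \<longleftrightarrow>
     (\<forall>xs i j. length xs = m \<longrightarrow> i < j \<longrightarrow> j < p \<longrightarrow>
        \<phi> (xs[i := xs ! j, j := xs ! i]) = - \<phi> xs)"

definition commutator ::
  "('k::field \<Rightarrow> 'a::ab_group_add \<Rightarrow> 'a) \<Rightarrow> nat \<Rightarrow> ('a list \<Rightarrow> 'a) \<Rightarrow> 'a list \<Rightarrow> 'a" where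
  "commutator scale m \<phi> xs =
     (\<Sum>i<m. scale ((-1) ^ (m - Suc i)) (\<phi> (omit_nth i xs @ [xs ! i])))"

locale pre_Lie_algebra = vector_space scale
  for scale :: "'k::field_char_0 \<Rightarrow> 'a::ab_group_add \<Rightarrow> 'a" +
  fixes m :: nat and \<phi> :: "'a list \<Rightarrow> 'a"
  assumes finite_dimensional: "\<exists>B. finite B \<and> span B = UNIV"
    and arity: "m \<ge> 2"
    and multilinear: "multilinear scale m \<phi>"
    and skew_symmetric: "skew_symmetric_first (m - 1) m \<phi>"
    and derivation_identity:
      "\<And>xs ys y. length xs = m - 1 \<Longrightarrow> length ys = m - 1 \<Longrightarrow>
         \<phi> (xs @ [\<phi> (ys @ [y])]) =
           (\<Sum>i<m - 1. \<phi> (ys[i := commutator scale m \<phi> (xs @ [ys ! i])] @ [y]))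
           + \<phi> (ys @ [\<phi> (xs @ [y])])"
    and commutator_identity:
      "\<And>xs ys. length xs = m \<Longrightarrow> length ys = m - 1 \<Longrightarrow>
         \<phi> (commutator scale m \<phi> xs # ys) =
           (\<Sum>i<m. scale ((-1) ^ (m - Suc i)) (\<phi> (omit_nth i xs @ [\<phi> (xs ! i # ys)])))"

definition is_trace ::
  "('k::field \<Rightarrow> 'a::ab_group_add \<Rightarrow> 'a) \<Rightarrow> nat \<Rightarrow> ('a list \<Rightarrow> 'a) \<Rightarrow> ('a \<Rightarrow> 'k) \<Rightarrow> bool" where
  "is_trace scale n \<phi> \<tau> \<longleftrightarrow>
     Vector_Spaces.linear scale (*) \<tau> \<and> (\<forall>xs. length xs = n \<longrightarrow> \<tau> (\<phi> xs) = 0)"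

text \<open>The operation \<open>\<phi>\<^sub>\<tau>\<close> of arity \<open>n + 1\<close>: the sum runs over all arguments but the last.\<close>

definition trace_extension ::
  "('k::field \<Rightarrow> 'a::ab_group_add \<Rightarrow> 'a) \<Rightarrow> nat \<Rightarrow> ('a list \<Rightarrow> 'a) \<Rightarrow> ('a \<Rightarrow> 'k) \<Rightarrow> 'a list \<Rightarrow> 'a" where
  "trace_extension scale n \<phi> \<tau> xs =
     (\<Sum>k<n. scale ((-1) ^ k * \<tau> (xs ! k)) (\<phi> (omit_nth k xs)))"

end

theory Submission imports Defs begin

text \<open>On the first \<open>n\<close> arguments, \<open>\<phi>\<^sub>\<tau>\<close> is \<open>\<phi>\<close> precomposed with the contraction by \<open>\<tau>\<close>, and the
  commutator of \<open>\<phi>\<^sub>\<tau>\<close> is likewise the contraction of the commutator of \<open>\<phi>\<close>. Since \<open>\<tau>\<close> kills every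
  value of \<open>\<phi>\<close>, both identities for \<open>\<phi>\<^sub>\<tau>\<close> reduce to the contracted identities for \<open>\<phi>\<close>, up to
  terms carrying a factor \<open>\<tau> x\<^sub>i * \<tau> x\<^sub>j\<close> from the same list. These cancel because contracting twice
  by \<open>\<tau>\<close> gives zero: omitting two entries in either order leaves the same list with opposite
  signs.\<close>

section \<open>Omitting list entries and reindexing sums over them\<close>

text \<open>Position in the original list of the entry at position \<open>k\<close> once position \<open>i\<close> is omitted.\<close>

definition skip :: "nat \<Rightarrow> nat \<Rightarrow> nat" where
  "skip i k = (if k < i then k else Suc k)"

lemma length_omit_nth: "i < length xs \<Longrightarrow> length (omit_nth i xs) = length xs - 1"
  by (simp add: omit_nth_def)

lemma nth_omit_nth: "i < length xs \<Longrightarrow> k < length xs - 1 \<Longrightarrow> omit_nth i xs ! k = xs ! skip i k"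
  by (auto simp: omit_nth_def skip_def nth_append)

lemma omit_nth_append: "i < length xs \<Longrightarrow> omit_nth i (xs @ ys) = omit_nth i xs @ ys"
  by (simp add: omit_nth_def)

lemma omit_nth_update_same: "omit_nth i (xs[i := v]) = omit_nth i xs"
  by (simp add: omit_nth_def)

lemma omit_nth_0_Cons: "omit_nth 0 (x # xs) = xs"
  by (simp add: omit_nth_def)

lemma omit_nth_Suc_Cons: "omit_nth (Suc k) (x # xs) = x # omit_nth k xs"
  by (simp add: omit_nth_def)

lemma skip_neq: "skip i k \<noteq> i"
  by (simp add: skip_def)

lemma omit_nth_update_skip:
  assumes "i < length xs" "k < length xs - 1"
  shows "omit_nth i (xs[skip i k := v]) = (omit_nth i xs)[k := v]"
  by (rule nth_equalityI)
    (use assms in \<open>auto simp: length_omit_nth nth_omit_nth nth_list_update skip_def split: if_splits\<close>)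

text \<open>A pair \<open>(i, k)\<close> encodes the distinct positions \<open>i\<close> and
  \<open>skip i k\<close>. Once \<open>skip i k\<close> is gone, \<open>i\<close> sits at
  \<open>i - 1\<close> or \<open>i\<close>, depending on the side of the gap, so both orders delete
  the same two entries.\<close>

lemma omit_nth_omit_nth:
  assumes "i < length xs" "k < length xs - 1"
  shows "omit_nth (if k < i then i - 1 else i) (omit_nth (skip i k) xs) = omit_nth k (omit_nth i xs)"
  by (rule nth_equalityI)
    (use assms in \<open>auto simp: length_omit_nth nth_omit_nth skip_def\<close>)

lemma ex_skip: "j \<noteq> i \<Longrightarrow> i < Suc n \<Longrightarrow> j < Suc n \<Longrightarrow> \<exists>k<n. j = skip i k"
  by (rule exI[of _ "if j < i then j else j - 1"]) (auto simp: skip_def)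

lemma sum_remove_skip:
  fixes f :: "nat \<Rightarrow> 'b::comm_monoid_add"
  assumes "i < Suc n"
  shows "(\<Sum>j<Suc n. f j) = f i + (\<Sum>k<n. f (skip i k))"
proof -
  have "(\<Sum>k<n. f (skip i k)) = sum f ({..<Suc n} - {i})"
    by (rule sum.reindex_bij_witness[of _ "\<lambda>j. if j < i then j else j - 1" "skip i"])
      (use assms in \<open>auto simp: skip_def\<close>)
  then show ?thesis using assms by (simp add: sum.remove[of "{..<Suc n}" i] del: sum.lessThan_Suc)
qed

text \<open>Exchanging the order of the two omissions is an involution on the pairs
  \<open>(i, k)\<close>.\<close>

lemma sum_skip_swap:
  fixes f :: "nat \<Rightarrow> nat \<Rightarrow> 'b::comm_monoid_add"
  shows "(\<Sum>i<Suc n. \<Sum>k<n. f i k) = (\<Sum>i<Suc n. \<Sum>k<n. f (skip i k) (if k < i then i - 1 else i))"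
  unfolding sum.cartesian_product
  by (rule sum.reindex_bij_witness[of _ "\<lambda>(i, k). (skip i k, if k < i then i - 1 else i)"
        "\<lambda>(i, k). (skip i k, if k < i then i - 1 else i)"])
    (auto simp: skip_def)

lemma neg_one_power_diff: "k \<le> n \<Longrightarrow> (-1::'k::ring_1) ^ (n - k) = (-1) ^ (n + k)"
  by (simp add: minus_one_power_iff)

section \<open>Signs under exchange of two omissions\<close>

context vector_space
begin

text \<open>The involution of \<open>sum_skip_swap\<close> changes \<open>i + k\<close> by exactly
  one, so each sign flips, while the two omitted entries trade places in \<open>G\<close>.\<close>

lemma double_omission_antisym:
  assumes "length xs = Suc n"
  shows "(\<Sum>i<Suc n. \<Sum>k<n. scale ((-1) ^ (i + k)) (G (xs ! i) (omit_nth i xs ! k) (omit_nth k (omit_nth i xs))))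
       = - (\<Sum>i<Suc n. \<Sum>k<n. scale ((-1) ^ (i + k)) (G (omit_nth i xs ! k) (xs ! i) (omit_nth k (omit_nth i xs))))"
proof -
  have "scale ((-1) ^ (skip i k + (if k < i then i - 1 else i)))
      (G (xs ! skip i k) (omit_nth (skip i k) xs ! (if k < i then i - 1 else i))
        (omit_nth (if k < i then i - 1 else i) (omit_nth (skip i k) xs)))
    = - scale ((-1) ^ (i + k)) (G (omit_nth i xs ! k) (xs ! i) (omit_nth k (omit_nth i xs)))"
    if "i < Suc n" "k < n" for i k
  proof -
    have "omit_nth (skip i k) xs ! (if k < i then i - 1 else i) = xs ! i"
      by (subst nth_omit_nth) (use that assms in \<open>auto simp: skip_def\<close>)
    \<comment> \<open>If \<open>k < i\<close> then \<open>i > 0\<close>, so the natural subtraction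
      \<open>i - 1\<close> is exact.\<close>
    moreover have "(-1) ^ (skip i k + (if k < i then i - 1 else i)) = - ((-1) ^ (i + k) :: 'a)"
      using that by (cases i) (auto simp: skip_def add.commute)
    ultimately show ?thesis
      using omit_nth_omit_nth[of i xs k] nth_omit_nth[of i xs k] that assms
      by (simp add: scale_minus_left)
  qed
  then show ?thesis
    by (subst sum_skip_swap) (simp add: sum_negf)
qed

text \<open>Putting an entry last and then contracting by \<open>t\<close> agrees with contracting
  first: the minus sign from \<open>double_omission_antisym\<close> is absorbed by the
  \<open>Suc\<close> in \<open>n - Suc k\<close>.\<close>

lemma sum_contraction_omit_swap:
  assumes "length xs = Suc n"
  shows "(\<Sum>i<Suc n. scale ((-1) ^ (n - i)) (\<Sum>k<n. scale ((-1) ^ k * t (omit_nth i xs ! k))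
            (F (omit_nth k (omit_nth i xs)) (xs ! i))))
       = (\<Sum>i<Suc n. scale ((-1) ^ i * t (xs ! i)) (\<Sum>k<n. scale ((-1) ^ (n - Suc k))
            (F (omit_nth k (omit_nth i xs)) (omit_nth i xs ! k))))"
    (is "?L = ?R")
proof -
  let ?G = "\<lambda>x y zs. scale (t y) (F zs x)"
  have "?L = scale ((-1) ^ n) (\<Sum>i<Suc n. \<Sum>k<n. scale ((-1) ^ (i + k))
      (?G (xs ! i) (omit_nth i xs ! k) (omit_nth k (omit_nth i xs))))"
    unfolding scale_sum_right
    by (intro sum.cong refl) (simp add: neg_one_power_diff power_add mult_ac)
  also have "\<dots> = ?R"
    unfolding double_omission_antisym[OF assms, of ?G] scale_sum_right scale_minus_right sum_negf[symmetric]
    by (intro sum.cong refl)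
      (simp add: neg_one_power_diff power_add mult_ac Suc_le_eq)
  finally show ?thesis .
qed

end

text \<open>Turns antisymmetry of a sum into its vanishing, by way of characteristic zero.\<close>

lemma (in vector_space) scale_eq_neg_self:
  fixes v :: 'b
  assumes "v = - v" "(2::'a) \<noteq> 0"
  shows "v = 0"
proof -
  have "scale 2 v = v + v" by (metis one_add_one scale_left_distrib scale_one)
  then show ?thesis using assms by (metis add.right_inverse scale_eq_0_iff)
qed

section \<open>Skew-symmetry and linearity of \<open>\<phi>\<close> at a given slot\<close>

context pre_Lie_algebra
begin

text \<open>Adjacent transpositions carry \<open>c\<close> left past \<open>as\<close>, one sign
  each, hence the induction from the right end. The bound on \<open>as\<close> keeps
  \<open>c\<close> out of the last slot, where no symmetry is assumed.\<close>

lemma op_move_to_front: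
  assumes "length as + length bs = m - 1" "length as < m - 1"
  shows "\<phi> (as @ c # bs) = scale ((-1) ^ length as) (\<phi> (c # as @ bs))"
  using assms
proof (induction as arbitrary: bs rule: rev_induct)
  case Nil
  then show ?case by simp
next
  case (snoc a as)
  let ?xs = "as @ c # a # bs"
  have "\<phi> (?xs[length as := ?xs ! Suc (length as), Suc (length as) := ?xs ! length as]) = - \<phi> ?xs"
    using skew_symmetric[unfolded skew_symmetric_first_def, rule_format, of ?xs "length as" "Suc (length as)"]
      snoc.prems by simp
  moreover have "?xs[length as := ?xs ! Suc (length as), Suc (length as) := ?xs ! length as] = as @ a # c # bs"
    by (simp add: nth_append list_update_append)
  ultimately have "\<phi> (as @ a # c # bs) = - \<phi> ?xs" by simp
  with snoc show ?case by simp
qed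

lemma op_update_eq:
  assumes "length xs = m" "i < m - 1"
  shows "\<phi> (xs[i := c]) = scale ((-1) ^ i) (\<phi> (c # omit_nth i xs))"
  using op_move_to_front[of "take i xs" "drop (Suc i) xs" c] assms
  by (simp add: upd_conv_take_nth_drop omit_nth_def)

lemma op_update_snoc_eq:
  assumes "length xs = m - 1" "i < m - 1"
  shows "\<phi> (xs[i := c] @ [y]) = scale ((-1) ^ i) (\<phi> (c # omit_nth i xs @ [y]))"
  using op_update_eq[of "xs @ [y]" i c] assms arity
  by (simp add: list_update_append omit_nth_append)

lemma linear_op_update: "length xs = m \<Longrightarrow> i < m \<Longrightarrow> Vector_Spaces.linear scale scale (\<lambda>v. \<phi> (xs[i := v]))"
  using multilinear by (simp add: multilinear_def)

lemma
  assumes "length xs + length ys = m - 1"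
  shows op_sum: "\<phi> (xs @ (\<Sum>a\<in>S. f a) # ys) = (\<Sum>a\<in>S. \<phi> (xs @ f a # ys))"
    and op_add: "\<phi> (xs @ (u + v) # ys) = \<phi> (xs @ u # ys) + \<phi> (xs @ v # ys)"
    and op_scale: "\<phi> (xs @ scale c v # ys) = scale c (\<phi> (xs @ v # ys))"
proof -
  interpret L: Vector_Spaces.linear scale scale "\<lambda>v. \<phi> (xs @ v # ys)"
    \<comment> \<open>The \<open>0\<close> is a placeholder, overwritten by the update at position
      \<open>length xs\<close>.\<close>
    using linear_op_update[of "xs @ 0 # ys" "length xs"] assms arity by simp
  show "\<phi> (xs @ (\<Sum>a\<in>S. f a) # ys) = (\<Sum>a\<in>S. \<phi> (xs @ f a # ys))" by (rule L.sum)
  show "\<phi> (xs @ (u + v) # ys) = \<phi> (xs @ u # ys) + \<phi> (xs @ v # ys)" by (rule L.add)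
  show "\<phi> (xs @ scale c v # ys) = scale c (\<phi> (xs @ v # ys))" by (rule L.scale)
qed

end

section \<open>Contraction by a trace and the resulting commutator\<close>

locale traced_pre_Lie_algebra = pre_Lie_algebra +
  fixes \<tau>
  assumes is_trace: "is_trace scale m \<phi> \<tau>"
begin

abbreviation ext where "ext \<equiv> trace_extension scale m \<phi> \<tau>"

lemma
  shows trace_add: "\<tau> (u + v) = \<tau> u + \<tau> v"
    and trace_scale: "\<tau> (scale c v) = c * \<tau> v"
    and trace_sum: "\<tau> (\<Sum>a\<in>S. f a) = (\<Sum>a\<in>S. \<tau> (f a))"
proof -
  interpret L: Vector_Spaces.linear scale "(*)" \<tau>
    using is_trace by (simp add: is_trace_def)
  show "\<tau> (u + v) = \<tau> u + \<tau> v" by (rule L.add)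
  show "\<tau> (scale c v) = c * \<tau> v" by (rule L.scale)
  show "\<tau> (\<Sum>a\<in>S. f a) = (\<Sum>a\<in>S. \<tau> (f a))" by (rule L.sum)
qed

lemma trace_op: "length xs = m \<Longrightarrow> \<tau> (\<phi> xs) = 0"
  using is_trace by (simp add: is_trace_def)

lemma ext_snoc:
  assumes "length xs = m"
  shows "ext (xs @ [y]) = (\<Sum>k<m. scale ((-1) ^ k * \<tau> (xs ! k)) (\<phi> (omit_nth k xs @ [y])))"
  unfolding trace_extension_def
  by (intro sum.cong refl) (simp add: assms nth_append omit_nth_append)

text \<open>The term \<open>k = 0\<close> deletes \<open>x\<close>. All later terms keep
  \<open>x\<close> in front, and lowering their index by one produces the minus sign.\<close>

lemma ext_Cons:
  assumes "length ys = m"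
  shows "ext (x # ys) = scale (\<tau> x) (\<phi> ys)
    - (\<Sum>k<m - 1. scale ((-1) ^ k * \<tau> (ys ! k)) (\<phi> (x # omit_nth k ys)))"
proof -
  obtain n where n: "m = Suc n" using arity by (cases m) auto
  show ?thesis
    unfolding trace_extension_def n sum.lessThan_Suc_shift
    by (simp add: omit_nth_0_Cons omit_nth_Suc_Cons sum_negf)
qed

lemma trace_ext:
  assumes "length xs = Suc m"
  shows "\<tau> (ext xs) = 0"
  using assms unfolding trace_extension_def by (simp add: trace_sum trace_scale trace_op length_omit_nth)

text \<open>Removes, in both identities, the summands where \<open>\<tau>\<close> falls on an
  inserted commutator.\<close>

lemma trace_commutator_ext:
  assumes "length xs = Suc m"
  shows "\<tau> (commutator scale (Suc m) ext xs) = 0"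
  using assms unfolding commutator_def
  by (simp add: trace_sum trace_scale trace_ext length_omit_nth del: sum.lessThan_Suc)

lemma commutator_ext:
  assumes "length xs = Suc m"
  shows "commutator scale (Suc m) ext xs
    = (\<Sum>i<Suc m. scale ((-1) ^ i * \<tau> (xs ! i)) (commutator scale m \<phi> (omit_nth i xs)))"
proof -
  have "commutator scale (Suc m) ext xs = (\<Sum>i<Suc m. scale ((-1) ^ (m - i))
      (\<Sum>k<m. scale ((-1) ^ k * \<tau> (omit_nth i xs ! k)) (\<phi> (omit_nth k (omit_nth i xs) @ [xs ! i]))))"
    unfolding commutator_def
    by (intro sum.cong refl) (simp add: ext_snoc length_omit_nth assms)
  also have "\<dots> = (\<Sum>i<Suc m. scale ((-1) ^ i * \<tau> (xs ! i)) (commutator scale m \<phi> (omit_nth i xs)))"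
    unfolding sum_contraction_omit_swap[OF assms, of \<tau> "\<lambda>ws x. \<phi> (ws @ [x])"] commutator_def ..
  finally show ?thesis .
qed

text \<open>Isolates the summand where \<open>\<tau>\<close> hits the last entry; in the derivation
  identity these summands must cancel among themselves.\<close>

lemma commutator_ext_snoc:
  assumes "length xs = m"
  shows "commutator scale (Suc m) ext (xs @ [y])
    = (\<Sum>k<m. scale ((-1) ^ k * \<tau> (xs ! k)) (commutator scale m \<phi> (omit_nth k xs @ [y])))
      + scale ((-1) ^ m * \<tau> y) (commutator scale m \<phi> xs)"
proof -
  have "omit_nth m (xs @ [y]) = xs" using assms by (simp add: omit_nth_def)
  then show ?thesis
    using assms by (simp add: commutator_ext nth_append omit_nth_append)
qed

text \<open>The product of the two values of \<open>\<tau>\<close> is symmetric in the omitted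
  entries, but exchanging them reverses the sign, so the sum is its own negative.\<close>

lemma double_contraction_eq_0:
  assumes "length xs = Suc n"
  shows "(\<Sum>i<Suc n. \<Sum>k<n. scale ((-1) ^ (i + k) * (\<tau> (xs ! i) * \<tau> (omit_nth i xs ! k))) (g (omit_nth k (omit_nth i xs)))) = 0"
proof (rule scale_eq_neg_self)
  show "(\<Sum>i<Suc n. \<Sum>k<n. scale ((-1) ^ (i + k) * (\<tau> (xs ! i) * \<tau> (omit_nth i xs ! k))) (g (omit_nth k (omit_nth i xs)))) =
     - (\<Sum>i<Suc n. \<Sum>k<n. scale ((-1) ^ (i + k) * (\<tau> (xs ! i) * \<tau> (omit_nth i xs ! k))) (g (omit_nth k (omit_nth i xs))))"
    using double_omission_antisym[OF assms, of "\<lambda>x y zs. scale (\<tau> x * \<tau> y) (g zs)"]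
    by (simp add: mult_ac del: sum.lessThan_Suc)
qed simp

section \<open>Multilinearity and skew-symmetry of the extension\<close>

lemma multilinear_ext: "multilinear scale (Suc m) ext"
  unfolding multilinear_def
proof (intro allI impI)
  fix xs :: "'b list" and i assume xs: "length xs = Suc m" and i: "i < Suc m"
  interpret vector_space_pair scale scale ..
  have "Vector_Spaces.linear scale scale
      (\<lambda>v. scale ((-1) ^ k * \<tau> (xs[i := v] ! k)) (\<phi> (omit_nth k (xs[i := v]))))" if k: "k < m" for k
  \<comment> \<open>The varied argument enters either only through \<open>\<tau>\<close>, or only
    through a slot \<open>l\<close> of \<open>\<phi>\<close>.\<close>
  proof (cases "i = k")
    case True
    show ?thesis using True xs i
      by (simp add: omit_nth_update_same Vector_Spaces.linear_iff vector_space_axioms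
          trace_add trace_scale algebra_simps)
  next
    case False
    then obtain l where l: "l < m" "i = skip k l" using ex_skip[of i k m] k i by auto
    have "Vector_Spaces.linear scale scale (\<lambda>v. \<phi> ((omit_nth k xs)[l := v]))"
      using xs k l by (intro linear_op_update) (simp_all add: length_omit_nth)
    then show ?thesis using l xs k False
      by (simp add: omit_nth_update_skip linear_compose_scale_right)
  qed
  then show "Vector_Spaces.linear scale scale (\<lambda>v. ext (xs[i := v]))"
    unfolding trace_extension_def by (intro linear_compose_sum) auto
qed

text \<open>The omission discards \<open>u\<close>, and \<open>xs ! i\<close> takes the place of
  \<open>xs ! j\<close>. Moving \<open>xs ! i\<close> to the front on both sides leaves the same
  tail, so only signs remain to be compared.\<close>

lemma op_omit_nth_swap:
  assumes xs: "length xs = Suc m" and ij: "i \<noteq> j" "i < m" "j < m"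
  shows "\<phi> (omit_nth i (xs[i := u, j := xs ! i])) = - scale ((-1) ^ (i + j)) (\<phi> (omit_nth j xs))"
proof -
  obtain n where n: "m = Suc n" using arity by (cases m) auto
  obtain k where k: "k < n" "j = skip i k" using ex_skip[of j i n] ij n by auto
  define l where "l = (if k < i then i - 1 else i)"
  have l: "l < n" "i = skip j l" using k ij n by (auto simp: l_def skip_def split: if_splits)
  have "omit_nth i (xs[i := u, j := xs ! i]) = (omit_nth i xs)[k := xs ! i]"
    using k ij xs n by (simp add: omit_nth_update_skip omit_nth_update_same)
  then have "\<phi> (omit_nth i (xs[i := u, j := xs ! i])) = scale ((-1) ^ k) (\<phi> (xs ! i # omit_nth k (omit_nth i xs)))"
    using k ij xs n by (simp add: op_update_eq length_omit_nth)
  \<comment> \<open>Updating an entry by itself makes \<open>op_update_eq\<close> applicable on this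
    side too.\<close>
  moreover have "(omit_nth j xs)[l := xs ! i] = omit_nth j xs"
    using l ij xs n by (metis less_SucI list_update_id omit_nth_update_skip diff_Suc_1)
  then have "\<phi> (omit_nth j xs) = scale ((-1) ^ l) (\<phi> (xs ! i # omit_nth l (omit_nth j xs)))"
    using op_update_eq[of "omit_nth j xs" l "xs ! i"] l ij xs n by (simp add: length_omit_nth)
  moreover have "omit_nth l (omit_nth j xs) = omit_nth k (omit_nth i xs)"
    using omit_nth_omit_nth[of i xs k] k ij xs n by (simp add: l_def)
  moreover have "(-1) ^ k = - ((-1) ^ (i + j) * (-1) ^ l :: 'a)"
    using k ij by (cases i) (auto simp: l_def skip_def power_add)
  ultimately show ?thesis by simp
qed

lemma skew_symmetric_ext: "skew_symmetric_first m (Suc m) ext"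
  unfolding skew_symmetric_first_def
proof (intro allI impI)
  fix xs :: "'b list" and i j assume xs: "length xs = Suc m" and ij: "i < j" "j < m"
  obtain n where n: "m = Suc n" using arity by (cases m) auto
  define zs where "zs = xs[i := xs ! j, j := xs ! i]"
  have zs': "zs = xs[j := xs ! i, i := xs ! j]"
    using ij by (simp add: zs_def list_update_swap)
  define f where "f us k = scale ((-1) ^ k * \<tau> (us ! k)) (\<phi> (omit_nth k us))" for us k
  \<comment> \<open>Swapping arguments \<open>i\<close> and \<open>j\<close> turns the summand
    omitting \<open>k\<close> into minus the one omitting \<open>p k\<close>; \<open>p\<close> is
    its own inverse, so it reindexes the sum.\<close>
  define p where "p k = (if k = i then j else if k = j then i else k)" for k
  have "f zs k = - f xs (p k)" if "k < m" for k
  proof -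
    consider "k = i" | "k = j" | "k \<noteq> i" "k \<noteq> j" by blast
    then show ?thesis
    proof cases
      case 1
      then show ?thesis
        using op_omit_nth_swap[of xs i j "xs ! j"] ij xs
        by (simp add: f_def p_def zs_def power_add)
    next
      case 2
      then show ?thesis
        using op_omit_nth_swap[of xs j i "xs ! i"] ij xs
        by (simp add: f_def p_def zs' power_add)
    next
      case 3
      have "i < Suc n" "j < Suc n" "k < Suc n" using ij n that by auto
      then obtain a b where ab: "a < n" "i = skip k a" "b < n" "j = skip k b"
        using ex_skip[of i k n] ex_skip[of j k n] 3 by blast
      \<comment> \<open>\<open>skip k\<close> preserves order, so \<open>i < j\<close> descends to
        the shortened list.\<close>
      have "a < b" using ij ab by (auto simp: skip_def split: if_splits)
      let ?us = "omit_nth k xs"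
      have us: "length ?us = m" using that xs by (simp add: length_omit_nth)
      have "omit_nth k zs = ?us[a := xs ! j, b := xs ! i]"
        using ab that xs n by (simp add: zs_def omit_nth_update_skip)
      also have "\<dots> = ?us[a := ?us ! b, b := ?us ! a]"
        using ab that xs n by (simp add: nth_omit_nth)
      finally have "\<phi> (omit_nth k zs) = - \<phi> ?us"
        using skew_symmetric us \<open>a < b\<close> ab n by (simp add: skew_symmetric_first_def)
      then show ?thesis using 3 by (simp add: f_def p_def zs_def)
    qed
  qed
  then have "(\<Sum>k<m. f zs k) = (\<Sum>k<m. - f xs k)"
    by (intro sum.reindex_bij_witness[of _ p p]) (use ij in \<open>auto simp: p_def\<close>)
  then show "ext (xs[i := xs ! j, j := xs ! i]) = - ext xs"
    by (simp add: trace_extension_def f_def zs_def sum_negf)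
qed

section \<open>The derivation identity\<close>

lemma derivation_identity_ext:
  assumes xs: "length xs = m" and ys: "length ys = m"
  shows "ext (xs @ [ext (ys @ [y])]) =
    (\<Sum>i<m. ext (ys[i := commutator scale (Suc m) ext (xs @ [ys ! i])] @ [y])) + ext (ys @ [ext (xs @ [y])])"
proof -
  obtain n where n: "m = Suc n" using arity by (cases m) auto
  let ?C = "commutator scale m \<phi>"
  let ?D = "\<lambda>i. commutator scale (Suc m) ext (xs @ [ys ! i])"
  let ?s = "\<lambda>k. (-1) ^ k * \<tau> (xs ! k)"
  let ?t = "\<lambda>l. (-1) ^ l * \<tau> (ys ! l)"
  have expand: "ext (us @ [ext (vs @ [y])]) = (\<Sum>k<m. \<Sum>l<m. scale ((-1) ^ k * \<tau> (us ! k) * ((-1) ^ l * \<tau> (vs ! l)))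
      (\<phi> (omit_nth k us @ [\<phi> (omit_nth l vs @ [y])])))" if "length us = m" "length vs = m" for us vs
    by (simp add: ext_snoc that op_sum op_scale length_omit_nth scale_sum_right)
  have ident: "\<phi> (omit_nth k xs @ [\<phi> (omit_nth l ys @ [y])]) =
      (\<Sum>i<n. \<phi> ((omit_nth l ys)[i := ?C (omit_nth k xs @ [omit_nth l ys ! i])] @ [y]))
      + \<phi> (omit_nth l ys @ [\<phi> (omit_nth k xs @ [y])])" if "k < m" "l < m" for k l
    using derivation_identity[of "omit_nth k xs" "omit_nth l ys" y] that xs ys n
    by (simp add: length_omit_nth)
  have trD: "\<tau> (?D i) = 0" for i
    using xs by (simp add: trace_commutator_ext)
  have upd: "\<phi> ((omit_nth l ys)[i := v] @ [y]) = \<phi> (take i (omit_nth l ys) @ v # drop (Suc i) (omit_nth l ys) @ [y])"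
    if "l < m" "i < n" for l i v
    using that ys n by (simp add: upd_conv_take_nth_drop length_omit_nth)
  have len: "length (take i (omit_nth l ys)) + length (drop (Suc i) (omit_nth l ys) @ [y]) = m - 1"
    if "l < m" "i < n" for l i
    using that ys n by (simp add: length_omit_nth)
  \<comment> \<open>\<open>?A\<close> collects the terms contracting an entry of \<open>xs\<close>
    inside the commutator, \<open>?B\<close> those contracting its last argument, an entry of
    \<open>ys\<close>.\<close>
  let ?A = "\<lambda>l i. \<Sum>k<m. scale (?t l) (scale (?s k) (\<phi> ((omit_nth l ys)[i := ?C (omit_nth k xs @ [omit_nth l ys ! i])] @ [y])))"
  let ?B = "\<lambda>l i. scale (?t l) (scale ((-1) ^ m * \<tau> (omit_nth l ys ! i)) (\<phi> ((omit_nth l ys)[i := ?C xs] @ [y])))"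
  have "(\<Sum>i<m. ext (ys[i := ?D i] @ [y]))
      = (\<Sum>i<m. \<Sum>l<m. scale ((-1) ^ l * \<tau> (ys[i := ?D i] ! l)) (\<phi> (omit_nth l (ys[i := ?D i]) @ [y])))"
    by (simp add: ext_snoc ys)
  also have "\<dots> = (\<Sum>l<m. \<Sum>i<m. scale ((-1) ^ l * \<tau> (ys[i := ?D i] ! l)) (\<phi> (omit_nth l (ys[i := ?D i]) @ [y])))"
    by (rule sum.swap)
  \<comment> \<open>For fixed \<open>l\<close> the summand \<open>i = l\<close> vanishes because
    \<open>\<tau>\<close> kills the commutator; \<open>skip l\<close> enumerates the others.\<close>
  also have "\<dots> = (\<Sum>l<m. \<Sum>i<n. scale (?t l) (\<phi> ((omit_nth l ys)[i := ?D (skip l i)] @ [y])))"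
  proof (rule sum.cong[OF refl])
    fix l assume "l \<in> {..<m}"
    then have l: "l < m" by simp
    let ?g = "\<lambda>i. scale ((-1) ^ l * \<tau> (ys[i := ?D i] ! l)) (\<phi> (omit_nth l (ys[i := ?D i]) @ [y]))"
    have "?g l = 0" using l ys by (simp add: trD)
    moreover have "?g (skip l i) = scale (?t l) (\<phi> ((omit_nth l ys)[i := ?D (skip l i)] @ [y]))" if "i < n" for i
      using that l ys n by (simp add: skip_neq omit_nth_update_skip)
    ultimately show "(\<Sum>i<m. ?g i) = (\<Sum>i<n. scale (?t l) (\<phi> ((omit_nth l ys)[i := ?D (skip l i)] @ [y])))"
      using sum_remove_skip[of l n ?g] l unfolding n by (simp del: sum.lessThan_Suc)
  qed
  also have "\<dots> = (\<Sum>l<m. \<Sum>i<n. ?A l i + ?B l i)"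
  proof (intro sum.cong refl)
    fix l i assume "l \<in> {..<m}" "i \<in> {..<n}"
    then have li: "l < m" "i < n" by auto
    then have "ys ! skip l i = omit_nth l ys ! i" using ys n by (simp add: nth_omit_nth)
    then show "scale (?t l) (\<phi> ((omit_nth l ys)[i := ?D (skip l i)] @ [y])) = ?A l i + ?B l i"
      by (simp add: commutator_ext_snoc xs upd li op_sum op_add op_scale len scale_sum_right scale_right_distrib
          del: length_append length_drop length_take)
  qed
  also have "\<dots> = (\<Sum>l<m. \<Sum>i<n. ?A l i) + (\<Sum>l<m. \<Sum>i<n. ?B l i)"
    by (simp only: sum.distrib)
  \<comment> \<open>With \<open>?C xs\<close> moved to the front, the rest depends only on the
    twice-shortened \<open>ys\<close>, and the sign is the one needed for
    \<open>double_contraction_eq_0\<close>.\<close>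
  also have "(\<Sum>l<m. \<Sum>i<n. ?B l i) = scale ((-1) ^ m) (\<Sum>l<Suc n. \<Sum>i<n.
      scale ((-1) ^ (l + i) * (\<tau> (ys ! l) * \<tau> (omit_nth l ys ! i))) (\<phi> (?C xs # omit_nth i (omit_nth l ys) @ [y])))"
    unfolding n[symmetric] scale_sum_right
    by (intro sum.cong refl)
      (use ys n in \<open>simp add: op_update_snoc_eq length_omit_nth power_add mult_ac\<close>)
  also have "\<dots> = 0"
    using double_contraction_eq_0[of ys n "\<lambda>zs. \<phi> (?C xs # zs @ [y])"] ys n by simp
  also have "(\<Sum>l<m. \<Sum>i<n. ?A l i) = (\<Sum>l<m. \<Sum>k<m. \<Sum>i<n. scale (?t l) (scale (?s k) (\<phi> ((omit_nth l ys)[i := ?C (omit_nth k xs @ [omit_nth l ys ! i])] @ [y]))))"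
    by (intro sum.cong refl sum.swap)
  also have "\<dots> = (\<Sum>k<m. \<Sum>l<m. \<Sum>i<n. scale (?t l) (scale (?s k) (\<phi> ((omit_nth l ys)[i := ?C (omit_nth k xs @ [omit_nth l ys ! i])] @ [y]))))"
    by (rule sum.swap)
  finally have first: "(\<Sum>i<m. ext (ys[i := ?D i] @ [y])) = (\<Sum>k<m. \<Sum>l<m. scale (?s k * ?t l)
      (\<Sum>i<n. \<phi> ((omit_nth l ys)[i := ?C (omit_nth k xs @ [omit_nth l ys ! i])] @ [y])))"
    by (simp add: scale_sum_right mult_ac)
  have second: "ext (ys @ [ext (xs @ [y])]) = (\<Sum>k<m. \<Sum>l<m. scale (?s k * ?t l)
      (\<phi> (omit_nth l ys @ [\<phi> (omit_nth k xs @ [y])])))"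
    unfolding expand[OF ys xs] by (subst sum.swap) (simp add: mult_ac)
  show ?thesis
    unfolding expand[OF xs ys] first second sum.distrib[symmetric] scale_right_distrib[symmetric]
    by (intro sum.cong refl arg_cong2[where f = scale]) (simp add: ident)
qed

section \<open>The commutator identity\<close>

text \<open>On the left only contractions over \<open>ys\<close> survive. On the right the
  contraction over \<open>xs\<close> is moved outside; terms with a second \<open>\<tau>\<close>
  factor from \<open>xs\<close> cancel, and the rest is the identity for \<open>\<phi>\<close> on
  each \<open>omit_nth i xs\<close>.\<close>

lemma commutator_identity_ext:
  assumes xs: "length xs = Suc m" and ys: "length ys = m"
  shows "ext (commutator scale (Suc m) ext xs # ys) =
    (\<Sum>i<Suc m. scale ((-1) ^ (m - i)) (ext (omit_nth i xs @ [ext (xs ! i # ys)])))"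
proof -
  let ?C = "commutator scale m \<phi>"
  let ?E = "commutator scale (Suc m) ext xs"
  let ?u = "\<lambda>k. (-1) ^ k * \<tau> (ys ! k)"
  have trE: "\<tau> ?E = 0"
    using xs by (simp add: trace_commutator_ext)
  have first: "\<phi> (?E # omit_nth k ys) = (\<Sum>i<Suc m. scale ((-1) ^ i * \<tau> (xs ! i)) (\<Sum>j<m. scale ((-1) ^ (m - Suc j))
      (\<phi> (omit_nth j (omit_nth i xs) @ [\<phi> (omit_nth i xs ! j # omit_nth k ys)]))))" if "k < m" for k
  proof -
    have len: "length [] + length (omit_nth k ys) = m - 1" using that ys by (simp add: length_omit_nth)
    show ?thesis
      unfolding commutator_ext[OF xs] op_sum[OF len, simplified] op_scale[OF len, simplified]
      by (intro sum.cong refl arg_cong2[where f = scale] commutator_identity)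
        (use that ys xs in \<open>simp_all add: length_omit_nth\<close>)
  qed
  let ?R = "\<lambda>g. \<Sum>i<Suc m. scale ((-1) ^ i * \<tau> (xs ! i)) (\<Sum>j<m. scale ((-1) ^ (m - Suc j))
      (\<phi> (omit_nth j (omit_nth i xs) @ [g (omit_nth i xs ! j)])))"
  have split: "\<phi> (ws @ [ext (x # ys)]) = scale (\<tau> x) (\<phi> (ws @ [\<phi> ys]))
      - (\<Sum>k<m - 1. scale (?u k) (\<phi> (ws @ [\<phi> (x # omit_nth k ys)])))" if "length ws = m - 1" for ws x
  proof -
    have len: "length ws + length [] = m - 1" using that by simp
    \<comment> \<open>The difference is written with a factor \<open>-1\<close> so that
      \<open>op_add\<close> and \<open>op_scale\<close> apply.\<close>
    have "ext (x # ys) = scale (\<tau> x) (\<phi> ys) + scale (-1) (\<Sum>k<m - 1. scale (?u k) (\<phi> (x # omit_nth k ys)))"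
      by (simp add: ext_Cons ys)
    then show ?thesis
      by (simp only: op_add[OF len] op_scale[OF len] op_sum[OF len]) simp
  qed
  \<comment> \<open>The inner value \<open>\<phi> ys\<close> is independent of \<open>i\<close> and
    \<open>j\<close>, which makes this a double contraction of \<open>xs\<close>.\<close>
  have van: "(\<Sum>i<Suc m. scale ((-1) ^ i * \<tau> (xs ! i)) (\<Sum>j<m. scale ((-1) ^ (m - Suc j))
      (scale (\<tau> (omit_nth i xs ! j)) (\<phi> (omit_nth j (omit_nth i xs) @ [\<phi> ys]))))) = 0"
  proof -
    have "(\<Sum>i<Suc m. scale ((-1) ^ i * \<tau> (xs ! i)) (\<Sum>j<m. scale ((-1) ^ (m - Suc j))
      (scale (\<tau> (omit_nth i xs ! j)) (\<phi> (omit_nth j (omit_nth i xs) @ [\<phi> ys])))))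
      = scale ((-1) ^ Suc m) (\<Sum>i<Suc m. \<Sum>k<m. scale ((-1) ^ (i + k) * (\<tau> (xs ! i) * \<tau> (omit_nth i xs ! k)))
         (\<phi> (omit_nth k (omit_nth i xs) @ [\<phi> ys])))"
      unfolding scale_sum_right
      by (intro sum.cong refl) (simp add: neg_one_power_diff power_add mult_ac Suc_le_eq)
    also have "\<dots> = 0"
      by (simp only: double_contraction_eq_0[OF xs, of "\<lambda>ws. \<phi> (ws @ [\<phi> ys])"] scale_zero_right)
    finally show ?thesis .
  qed
  have "(\<Sum>i<Suc m. scale ((-1) ^ (m - i)) (ext (omit_nth i xs @ [ext (xs ! i # ys)])))
    = (\<Sum>i<Suc m. scale ((-1) ^ (m - i)) (\<Sum>k<m. scale ((-1) ^ k * \<tau> (omit_nth i xs ! k))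
            (\<phi> (omit_nth k (omit_nth i xs) @ [ext (xs ! i # ys)]))))"
    by (intro sum.cong refl) (simp add: ext_snoc length_omit_nth xs)
  also have "\<dots> = ?R (\<lambda>x. ext (x # ys))"
    by (rule sum_contraction_omit_swap[OF xs, of \<tau> "\<lambda>ws x. \<phi> (ws @ [ext (x # ys)])"])
  also have "\<dots> = - (\<Sum>i<Suc m. scale ((-1) ^ i * \<tau> (xs ! i)) (\<Sum>j<m. scale ((-1) ^ (m - Suc j))
      (\<Sum>k<m - 1. scale (?u k) (\<phi> (omit_nth j (omit_nth i xs) @ [\<phi> (omit_nth i xs ! j # omit_nth k ys)])))))"
    (is "_ = - ?S")
  proof -
    have "?R (\<lambda>x. ext (x # ys)) = (\<Sum>i<Suc m. scale ((-1) ^ i * \<tau> (xs ! i)) (\<Sum>j<m. scale ((-1) ^ (m - Suc j))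
      (scale (\<tau> (omit_nth i xs ! j)) (\<phi> (omit_nth j (omit_nth i xs) @ [\<phi> ys]))
       - (\<Sum>k<m - 1. scale (?u k) (\<phi> (omit_nth j (omit_nth i xs) @ [\<phi> (omit_nth i xs ! j # omit_nth k ys)]))))))"
      by (intro sum.cong refl arg_cong2[where f = scale] split) (simp add: length_omit_nth xs)
    also have "\<dots> = 0 - ?S"
      unfolding van[symmetric] by (simp only: scale_right_diff_distrib sum_subtractf)
    finally show ?thesis by simp
  qed
  \<comment> \<open>With the sum over \<open>k\<close> outermost, each summand matches the right
    side of \<open>first\<close>.\<close>
  also have "?S = (\<Sum>k<m - 1. scale (?u k) (?R (\<lambda>x. \<phi> (x # omit_nth k ys))))"
  proof -
    have "?S = (\<Sum>i<Suc m. \<Sum>j<m. \<Sum>k<m - 1. scale ((-1) ^ i * \<tau> (xs ! i)) (scale ((-1) ^ (m - Suc j))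
      (scale (?u k) (\<phi> (omit_nth j (omit_nth i xs) @ [\<phi> (omit_nth i xs ! j # omit_nth k ys)])))))"
      by (simp only: scale_sum_right)
    also have "\<dots> = (\<Sum>i<Suc m. \<Sum>k<m - 1. \<Sum>j<m. scale ((-1) ^ i * \<tau> (xs ! i)) (scale ((-1) ^ (m - Suc j))
      (scale (?u k) (\<phi> (omit_nth j (omit_nth i xs) @ [\<phi> (omit_nth i xs ! j # omit_nth k ys)])))))"
      by (intro sum.cong refl sum.swap)
    also have "\<dots> = (\<Sum>k<m - 1. \<Sum>i<Suc m. \<Sum>j<m. scale ((-1) ^ i * \<tau> (xs ! i)) (scale ((-1) ^ (m - Suc j))
      (scale (?u k) (\<phi> (omit_nth j (omit_nth i xs) @ [\<phi> (omit_nth i xs ! j # omit_nth k ys)])))))"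
      by (rule sum.swap)
    finally show ?thesis
      by (simp only: scale_sum_right scale_scale mult_ac)
  qed
  also have "\<dots> = (\<Sum>k<m - 1. scale (?u k) (\<phi> (?E # omit_nth k ys)))"
    by (intro sum.cong refl arg_cong2[where f = scale] first[symmetric]) simp
  finally show ?thesis
    by (simp add: ext_Cons ys trE)
qed

section \<open>Assembling the axioms for the extension\<close>

lemma pre_Lie_algebra_ext: "pre_Lie_algebra scale (Suc m) ext"
proof
  show "\<exists>B. finite B \<and> span B = UNIV" by (rule finite_dimensional)
  show "2 \<le> Suc m" using arity by simp
  show "multilinear scale (Suc m) ext" by (rule multilinear_ext)
  show "skew_symmetric_first (Suc m - 1) (Suc m) ext" using skew_symmetric_ext by simp
next
  fix xs ys :: "'b list" and y
  assume "length xs = Suc m - 1" "length ys = Suc m - 1"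
  then show "ext (xs @ [ext (ys @ [y])]) =
      (\<Sum>i<Suc m - 1. ext (ys[i := commutator scale (Suc m) ext (xs @ [ys ! i])] @ [y]))
      + ext (ys @ [ext (xs @ [y])])"
    unfolding diff_Suc_1 by (rule derivation_identity_ext)
next
  fix xs ys :: "'b list"
  assume "length xs = Suc m" "length ys = Suc m - 1"
  then show "ext (commutator scale (Suc m) ext xs # ys) =
      (\<Sum>i<Suc m. scale ((-1) ^ (Suc m - Suc i)) (ext (omit_nth i xs @ [ext (xs ! i # ys)])))"
    unfolding diff_Suc_1 diff_Suc_Suc by (rule commutator_identity_ext)
qed

end

theorem theorem4p11:
  fixes scale :: "'k::field_char_0 \<Rightarrow> 'a::ab_group_add \<Rightarrow> 'a"
    and n :: nat and \<phi> :: "'a list \<Rightarrow> 'a" and \<tau> :: "'a \<Rightarrow> 'k"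
  assumes "n \<ge> 2"
    and "pre_Lie_algebra scale n \<phi>"
    and "is_trace scale n \<phi> \<tau>"
  shows "pre_Lie_algebra scale (n + 1) (trace_extension scale n \<phi> \<tau>)"
proof -
  interpret pre_Lie_algebra scale n \<phi> by fact
  interpret traced_pre_Lie_algebra scale n \<phi> \<tau> by unfold_locales fact
  show ?thesis using pre_Lie_algebra_ext by simp
qed

end
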